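(* Let $k\ge 1$ be an integer and $\beta>0$ a real number. If $0^k 1^{2^k} \geq_\beta 1^k 0^{2^k}$, then $\beta \leq 2^{1/k}$. Consequently, since $\lim_{k\to\infty}2^{1/k}=1$, for every fixed $\beta>1$ the relation $0^k 1^{2^k} \geq_\beta 1^k 0^{2^k}$ fails for all sufficiently large $k$.
   Context: Let $\beta$ be a positive real number. The beta expansion of a bit string $\alpha=a_1\cdots a_\ell\in\{0,1\}^\ell$ is $\alpha_\beta=\sum_{i=1}^{\ell}a_i\beta^{\ell-i}$. For bit strings $\alpha,\gamma$, write $\alpha\ge_\beta\gamma$ if $\alpha_\beta\ge\gamma_\beta$. Juxtaposition is concatenation, and $b^j$ denotes the string consisting of $j$ copies of the bit $b$. *)

theory Defs
  imports Complex_Main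
begin

text \<open>Bit strings are Boolean lists, with \<^const>\<open>True\<close> for the bit 1 and \<^const>\<open>False\<close> for
  the bit 0. List positions start at 0, so the bit \<open>a\<^sub>i\<close> is \<open>\<alpha> ! (i - 1)\<close>.\<close>

type_synonym bit_string = "bool list"

definition beta_expansion :: "real \<Rightarrow> bit_string \<Rightarrow> real" where
  "beta_expansion \<beta> \<alpha> = (\<Sum>i = 1..length \<alpha>. of_bool (\<alpha> ! (i - 1)) * \<beta> ^ (length \<alpha> - i))"

definition beta_ge :: "bit_string \<Rightarrow> real \<Rightarrow> bit_string \<Rightarrow> bool"
  ("(_ \<ge>\<^bsub>_\<^esub> _)" [51, 0, 51] 50) where
  "\<alpha> \<ge>\<^bsub>\<beta>\<^esub> \<gamma> \<longleftrightarrow> beta_expansion \<beta> \<alpha> \<ge> beta_expansion \<beta> \<gamma>"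

end

theory Submission
  imports Defs
begin

text \<open>Let S_m be the expansion of a block of m ones. Leading zeros contribute nothing and n
  trailing zeros multiply by \<beta>^n, so the comparison says S_k \<beta>^n \<le> S_n. If \<beta> >
  1, multiplying by \<beta> - 1 collapses both geometric sums to (\<beta>^k - 1) \<beta>^n \<le>
  \<beta>^n - 1 < \<beta>^n, whence \<beta>^k < 2 (\<open>power_less_2_if_beta_ge\<close>). If
  \<beta> \<le> 1, the bound is immediate from 2^(1/k) \<ge> 1. Since 2^(1/k) tends to 1, a fixed
  \<beta> > 1 eventually violates the bound.\<close>

lemma beta_expansion_Nil [simp]: "beta_expansion \<beta> [] = 0"
  by (simp add: beta_expansion_def)

text \<open>Replaces the indexed sum by a recursion on the list, so that the facts on concatenation
  and constant blocks become list inductions.\<close>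

lemma beta_expansion_Cons [simp]:
  "beta_expansion \<beta> (a # \<alpha>) = of_bool a * \<beta> ^ length \<alpha> + beta_expansion \<beta> \<alpha>"
proof -
  have "beta_expansion \<beta> (a # \<alpha>) =
      (\<Sum>i<Suc (length \<alpha>). of_bool ((a # \<alpha>) ! i) * \<beta> ^ (length \<alpha> - i))"
    \<comment> \<open>Shifting the index to start at 0 lets the leading bit split off as the term i
      = 0.\<close>
    unfolding beta_expansion_def by (rule sum.reindex_bij_witness[of _ Suc "\<lambda>i. i - 1"]) auto
  also have "\<dots> = of_bool a * \<beta> ^ length \<alpha> +
      (\<Sum>i<length \<alpha>. of_bool (\<alpha> ! i) * \<beta> ^ (length \<alpha> - Suc i))"
    by (simp only: sum.lessThan_Suc_shift) simp
  also have "(\<Sum>i<length \<alpha>. of_bool (\<alpha> ! i) * \<beta> ^ (length \<alpha> - Suc i)) = beta_expansion \<beta> \<alpha>"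
    unfolding beta_expansion_def
    by (rule sum.reindex_bij_witness[of _ "\<lambda>i. i - 1" Suc]) auto
  finally show ?thesis .
qed

lemma beta_expansion_append:
  "beta_expansion \<beta> (\<alpha> @ \<gamma>) = beta_expansion \<beta> \<alpha> * \<beta> ^ length \<gamma> + beta_expansion \<beta> \<gamma>"
  by (induction \<alpha>) (simp_all add: power_add algebra_simps)

lemma beta_expansion_replicate_False [simp]: "beta_expansion \<beta> (replicate n False) = 0"
  by (induction n) simp_all

text \<open>The geometric sum, kept in product form so that no division by \<beta> - 1
  occurs.\<close>

lemma beta_expansion_replicate_True:
  "(\<beta> - 1) * beta_expansion \<beta> (replicate n True) = \<beta> ^ n - 1"
  by (induction n) (simp_all add: algebra_simps)

lemma power_less_2_if_beta_ge:
  assumes "\<beta> > 1"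
    and ge: "replicate k False @ replicate n True \<ge>\<^bsub>\<beta>\<^esub> replicate k True @ replicate n False"
  shows "\<beta> ^ k < 2"
proof -
  have "beta_expansion \<beta> (replicate k True) * \<beta> ^ n \<le> beta_expansion \<beta> (replicate n True)"
    using ge by (simp add: beta_ge_def beta_expansion_append)
  then have "(\<beta> - 1) * (beta_expansion \<beta> (replicate k True) * \<beta> ^ n)
      \<le> (\<beta> - 1) * beta_expansion \<beta> (replicate n True)"
    using \<open>\<beta> > 1\<close> by (intro mult_left_mono) auto
  then have "(\<beta> ^ k - 1) * \<beta> ^ n \<le> \<beta> ^ n - 1"
    by (metis beta_expansion_replicate_True mult.assoc)
  \<comment> \<open>Rearranged, the product is at least 1; this makes the final inequality
    strict.\<close>
  then have "0 < (2 - \<beta> ^ k) * \<beta> ^ n"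
    by (simp add: algebra_simps)
  then show ?thesis
    using \<open>\<beta> > 1\<close> by (simp add: zero_less_mult_iff)
qed

lemma beta_ge_imp_le_powr:
  assumes "k \<ge> 1" "\<beta> > 0"
    and ge: "replicate k False @ replicate n True \<ge>\<^bsub>\<beta>\<^esub> replicate k True @ replicate n False"
  shows "\<beta> \<le> 2 powr (1 / real k)"
proof (cases "\<beta> > 1")
  case True
  \<comment> \<open>Taking k-th roots of \<beta>^k < 2; here k \<ge> 1 ensures k * (1/k) =
    1.\<close>
  have "\<beta> = (\<beta> ^ k) powr (1 / real k)"
    using assms by (simp add: powr_powr flip: powr_realpow)
  also have "\<dots> \<le> 2 powr (1 / real k)"
    using power_less_2_if_beta_ge[OF True ge] \<open>\<beta> > 0\<close> by (intro powr_mono2) auto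
  finally show ?thesis .
next
  case False
  moreover have "1 \<le> 2 powr (1 / real k)"
    by (simp add: ge_one_powr_ge_zero)
  ultimately show ?thesis by linarith
qed

text \<open>Continuity of \<open>powr\<close> in the exponent, as 1/k tends to 0; the limit
  \<open>c powr 0\<close> is 1 because c is nonzero.\<close>

lemma tendsto_powr_inverse_of_nat:
  fixes c :: real
  assumes "c > 0"
  shows "(\<lambda>k. c powr (1 / real k)) \<longlonglongrightarrow> 1"
  using tendsto_powr[OF tendsto_const lim_1_over_n, of c] assms by simp

theorem proposition35:
  shows "(\<forall>(k::nat) (\<beta>::real). k \<ge> 1 \<longrightarrow> \<beta> > 0 \<longrightarrow>
            replicate k False @ replicate (2 ^ k) True \<ge>\<^bsub>\<beta>\<^esub> replicate k True @ replicate (2 ^ k) False \<longrightarrow>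
            \<beta> \<le> 2 powr (1 / real k)) \<and>
         ((\<lambda>k::nat. (2::real) powr (1 / real k)) \<longlonglongrightarrow> 1) \<and>
         (\<forall>\<beta>::real. \<beta> > 1 \<longrightarrow>
            (\<forall>\<^sub>F k::nat in sequentially.
               \<not> (replicate k False @ replicate (2 ^ k) True \<ge>\<^bsub>\<beta>\<^esub> replicate k True @ replicate (2 ^ k) False)))"
proof (intro conjI allI impI)
  show "\<beta> \<le> 2 powr (1 / real k)"
    if "k \<ge> 1" "\<beta> > 0"
      "replicate k False @ replicate (2 ^ k) True \<ge>\<^bsub>\<beta>\<^esub> replicate k True @ replicate (2 ^ k) False"
    for k \<beta>
    using that by (rule beta_ge_imp_le_powr)
  show lim: "(\<lambda>k::nat. (2::real) powr (1 / real k)) \<longlonglongrightarrow> 1"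
    by (rule tendsto_powr_inverse_of_nat) simp
  fix \<beta> :: real
  assume "\<beta> > 1"
  \<comment> \<open>As the limit 1 lies below \<beta>, eventually 2^(1/k) < \<beta>, against the
    bound, which is available once k \<ge> 1.\<close>
  from order_tendstoD(2)[OF lim this] eventually_ge_at_top[of 1]
  show "\<forall>\<^sub>F k in sequentially.
      \<not> (replicate k False @ replicate (2 ^ k) True \<ge>\<^bsub>\<beta>\<^esub> replicate k True @ replicate (2 ^ k) False)"
  proof eventually_elim
    case (elim k)
    then show ?case
      using beta_ge_imp_le_powr[of k \<beta> "2 ^ k"] \<open>\<beta> > 1\<close> by auto
  qed
qed

end
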